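(* Let $N\ge 2$, let $\mathscr{P}=\{\mathbf{P}_{0}=\mathbf{p}_{0}\cdot\mu,\ldots,\mathbf{P}_{N}=\mathbf{p}_{N}\cdot\mu\}$ be a family of $N+1$ distinct probabilities dominated by a measure $\mu$ on a measurable space $(\mathbf{E},\mathcal{E})$, put $\mathcal{J}=\{0,\ldots,N\}$, and let $$\overline{\mathcal{B}}(\mathscr{P})=\sup_{\widehat T}\ \frac{1}{N+1}\sum_{j=0}^{N}\mathbf{P}_{j}\left[\widehat T(\boldsymbol{X})=j\right],$$ where the supremum runs over all estimators $\widehat T(\boldsymbol{X})$ with values in $\mathcal{J}$. Let $$\widetilde K=\frac{1}{N+1}\sum_{j=0}^{N}K\left(\mathbf{P}_{j},\overline{\mathbf{P}}\right),\qquad \overline{\mathbf{P}}=\frac{1}{N+1}\sum_{j=0}^{N}\mathbf{P}_{j},$$ where $K(\cdot,\cdot)$ is the Kullback-Leibler divergence. Then $$\overline{\mathcal{B}}(\mathscr{P})\le \frac{\widetilde K+N/(N+1)}{\log(N+1)}\le \frac{\widetilde K+1}{\log(N+1)}.$$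
   Context: The notation $\mathbf{P}=\mathbf{p}\cdot\mu$ means that $\mathbf{P}$ is the probability on $(\mathbf{E},\mathcal{E})$ with density $\mathbf{p}$ with respect to $\mu$. The observation $\boldsymbol{X}$ takes its values in $\mathbf{E}$, and $\mathbf{P}_{j}[\widehat T(\boldsymbol{X})=j]$ is the probability of the event when $\boldsymbol{X}$ has distribution $\mathbf{P}_{j}$. An estimator with values in $\mathcal{J}$ is a measurable function $\widehat T:\mathbf{E}\to\mathcal{J}$ evaluated at $\boldsymbol{X}$. The Kullback-Leibler divergence between $\mathbf{P}=\mathbf{p}\cdot\mu$ and $\mathbf{Q}=\mathbf{q}\cdot\mu$ is $K(\mathbf{P},\mathbf{Q})=\int_{\mathbf{E}}\mathbf{p}\log(\mathbf{p}/\mathbf{q})\,d\mu$ when $\mathbf{P}\ll\mathbf{Q}$ (with the convention that the integrand is $0$ where $\mathbf{p}=0$), and $+\infty$ otherwise; $\log$ is the natural logarithm. *)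

theory Defs
  imports "HOL-Probability.Probability"
begin

text \<open>
  Divergence of the probabilities with real-valued densities \<open>p\<close> and \<open>q\<close> with respect to \<open>\<mu>\<close>.
  The two nonnegative integrals are those of the positive and negative parts (\<open>ennreal\<close> maps
  negative reals to 0), so that their difference is the Lebesgue integral with values in the
  extended reals; the Bochner integral would be 0 for a non-integrable integrand. The negative
  part always has integral at most 1. The integrand is 0 where \<open>p\<close> vanishes; under absolute
  continuity the points with \<open>p > 0\<close>, \<open>q = 0\<close> form a null set.
\<close>
definition KL_density :: "'a measure \<Rightarrow> ('a \<Rightarrow> real) \<Rightarrow> ('a \<Rightarrow> real) \<Rightarrow> ereal" where
  "KL_density \<mu> p q =
    (if absolutely_continuous (density \<mu> (\<lambda>x. ennreal (q x))) (density \<mu> (\<lambda>x. ennreal (p x)))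
     then enn2ereal (\<integral>\<^sup>+ x. ennreal (p x * ln (p x / q x)) \<partial>\<mu>)
        - enn2ereal (\<integral>\<^sup>+ x. ennreal (- (p x * ln (p x / q x))) \<partial>\<mu>)
     else \<infinity>)"

definition mean_density :: "nat \<Rightarrow> (nat \<Rightarrow> 'a \<Rightarrow> real) \<Rightarrow> 'a \<Rightarrow> real" where
  "mean_density N p x = 1 / real (N + 1) * (\<Sum>j = 0..N. p j x)"

text \<open>\<open>mean_density\<close> is a density of the average of the probabilities.\<close>
lemma emeasure_mean_density:
  fixes \<mu> :: "'a measure"
  assumes "\<And>j. j \<le> N \<Longrightarrow> p j \<in> borel_measurable \<mu>"
    and "\<And>j x. j \<le> N \<Longrightarrow> x \<in> space \<mu> \<Longrightarrow> 0 \<le> p j x"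
    and A: "A \<in> sets \<mu>"
  shows "emeasure (density \<mu> (\<lambda>x. ennreal (mean_density N p x))) A =
    ennreal (1 / real (N + 1)) * (\<Sum>j = 0..N. emeasure (density \<mu> (\<lambda>x. ennreal (p j x))) A)"
proof -
  have m: "mean_density N p \<in> borel_measurable \<mu>"
    unfolding mean_density_def[abs_def] using assms(1) by (intro borel_measurable_times
      borel_measurable_sum borel_measurable_const) auto
  have "emeasure (density \<mu> (\<lambda>x. ennreal (mean_density N p x))) A =
    (\<integral>\<^sup>+ x. ennreal (mean_density N p x) * indicator A x \<partial>\<mu>)"
    using m A by (intro emeasure_density) auto
  also have "\<dots> = (\<integral>\<^sup>+ x. ennreal (1 / real (N + 1)) *
      (\<Sum>j = 0..N. ennreal (p j x) * indicator A x) \<partial>\<mu>)"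
  proof (rule nn_integral_cong)
    fix x assume x: "x \<in> space \<mu>"
    have s: "ennreal (\<Sum>j = 0..N. p j x) = (\<Sum>j = 0..N. ennreal (p j x))"
      using assms(2) x by (intro sum_ennreal[symmetric]) simp
    have "ennreal (mean_density N p x) = ennreal (1 / real (N + 1)) * (\<Sum>j = 0..N. ennreal (p j x))"
      unfolding mean_density_def s[symmetric] using assms(2) x
      by (intro ennreal_mult sum_nonneg) simp_all
    then show "ennreal (mean_density N p x) * indicator A x =
      ennreal (1 / real (N + 1)) * (\<Sum>j = 0..N. ennreal (p j x) * indicator A x)"
      by (simp add: sum_distrib_right mult.assoc)
  qed
  also have "\<dots> = ennreal (1 / real (N + 1)) *
      (\<Sum>j = 0..N. \<integral>\<^sup>+ x. ennreal (p j x) * indicator A x \<partial>\<mu>)"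
  proof -
    have pm: "(\<lambda>x. ennreal (p j x) * indicator A x) \<in> borel_measurable \<mu>" if "j \<in> {0..N}" for j
      using assms(1)[of j] that A by simp
    then have "(\<integral>\<^sup>+ x. (\<Sum>j = 0..N. ennreal (p j x) * indicator A x) \<partial>\<mu>) =
        (\<Sum>j = 0..N. \<integral>\<^sup>+ x. ennreal (p j x) * indicator A x \<partial>\<mu>)"
      by (rule nn_integral_sum)
    moreover have "(\<lambda>x. \<Sum>j = 0..N. ennreal (p j x) * indicator A x) \<in> borel_measurable \<mu>"
      using pm by (rule borel_measurable_sum)
    ultimately show ?thesis by (simp only: nn_integral_cmult)
  qed
  also have "\<dots> = ennreal (1 / real (N + 1)) *
      (\<Sum>j = 0..N. emeasure (density \<mu> (\<lambda>x. ennreal (p j x))) A)"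
    using assms(1) A by (intro arg_cong2[where f="(*)"] sum.cong refl emeasure_density[symmetric]) auto
  finally show ?thesis .
qed

definition mean_KL :: "'a measure \<Rightarrow> nat \<Rightarrow> (nat \<Rightarrow> 'a \<Rightarrow> real) \<Rightarrow> ereal" where
  "mean_KL \<mu> N p =
    ereal (1 / real (N + 1)) * (\<Sum>j = 0..N. KL_density \<mu> (p j) (mean_density N p))"

text \<open>For probabilities \<open>P j\<close> the supremum is over a nonempty set of reals bounded by 1.\<close>
definition max_mean_success :: "'a measure \<Rightarrow> nat \<Rightarrow> (nat \<Rightarrow> 'a measure) \<Rightarrow> real" where
  "max_mean_success \<mu> N P =
    (SUP T \<in> measurable \<mu> (count_space {0..N}).
      1 / real (N + 1) * (\<Sum>j = 0..N. measure (P j) {x \<in> space \<mu>. T x = j}))"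

end

theory Submission
  imports Defs
begin

text \<open>
  Write \<open>n = N + 1\<close> and \<open>m\<close> for the mean density. The bound is the integral of a pointwise
  inequality between densities. Everything rests on \<open>a ln (a / b) \<ge> a - b\<close>
  (\<open>diff_le_mult_ln_divide\<close>), which is used at a point \<open>x\<close> with \<open>T x = t\<close> as follows: for
  \<open>j \<noteq> t\<close> it is applied to \<open>p j\<close> and \<open>m\<close>, whereas for \<open>j = t\<close> it is applied to \<open>p t\<close> and
  \<open>n m\<close>, which gives \<open>p t ln (p t / m) \<ge> p t ln n + p t - n m\<close>. Since the \<open>p j\<close> add up to \<open>n m\<close>,
  the sum over all \<open>j\<close> leaves
  \<open>(\<Sum>j. p j ln (p j / m)) \<ge> p t ln n - N m\<close> (\<open>sum_mult_ln_ge\<close>). Dividing by \<open>n\<close> and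
  integrating turns the left side into the mean divergence, \<open>p t\<close> into the mean success
  probability of \<open>T\<close>, and \<open>N m\<close> into \<open>N / n\<close>.

  No infinite divergence can occur here: \<open>p j \<le> n m\<close> bounds the integrand
  \<open>p j ln (p j / m)\<close> between \<open>p j - m\<close> and \<open>p j ln n\<close>, so that each divergence is a finite
  Bochner integral (\<open>KL_density_eq_integral\<close>).
\<close>

section \<open>Pointwise inequalities\<close>

lemma diff_le_mult_ln_divide:
  fixes a b :: real
  assumes "0 \<le> a" "0 < b"
  shows "a - b \<le> a * ln (a / b)"
proof (cases "a = 0")
  case False
  then have "0 < a" using assms by simp
  have "ln (b / a) \<le> b / a - 1"
    using \<open>0 < a\<close> assms by (intro ln_le_minus_one) simp
  then have "a * ln (b / a) \<le> a * (b / a - 1)"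
    using assms by (intro mult_left_mono) auto
  then show ?thesis
    using \<open>0 < a\<close> assms by (simp add: ln_div algebra_simps)
qed (use assms in simp)

lemma mult_ln_divide_le:
  fixes a b c :: real
  assumes "0 \<le> a" "a \<le> c * b" "0 < b" "0 < c"
  shows "a * ln (a / b) \<le> a * ln c"
proof (cases "a = 0")
  case False
  then have "ln (a / b) \<le> ln c"
    using assms by (subst ln_le_cancel_iff) (auto simp: field_simps)
  then show ?thesis using assms by (intro mult_left_mono) auto
qed simp

lemma le_mult_mean_density:
  assumes "\<And>j. j \<le> N \<Longrightarrow> 0 \<le> p j x" and "j \<le> N"
  shows "p j x \<le> real (N + 1) * mean_density N p x"
proof -
  have "p j x \<le> (\<Sum>j = 0..N. p j x)"
    using assms by (intro member_le_sum) auto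
  then show ?thesis by (simp add: mean_density_def)
qed

lemma sum_mult_ln_ge:
  fixes a :: "nat \<Rightarrow> real"
  assumes nonneg: "\<And>j. j \<le> N \<Longrightarrow> 0 \<le> a j"
    and total: "(\<Sum>j = 0..N. a j) = real (N + 1) * m"
    and t: "t \<le> N"
  shows "a t * ln (real (N + 1)) - real N * m \<le> (\<Sum>j = 0..N. a j * ln (a j / m))"
proof (cases "m = 0")
  case True
  then have "\<forall>j \<in> {0..N}. a j = 0"
    using total nonneg sum_nonneg_eq_0_iff[of "{0..N}" a] by simp
  then show ?thesis using True t by simp
next
  case False
  have "0 \<le> real (N + 1) * m"
    unfolding total[symmetric] using nonneg by (intro sum_nonneg) auto
  with False have m: "0 < m" by (simp add: zero_le_mult_iff)
  have at: "a t * ln (real (N + 1)) + a t - real (N + 1) * m \<le> a t * ln (a t / m)"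
  proof (cases "a t = 0")
    case True
    then show ?thesis using m by simp
  next
    case False
    then have "0 < a t" using nonneg[OF t] by simp
    then have "ln (a t / (real (N + 1) * m)) = ln (a t / m) - ln (real (N + 1))"
      using m by (simp add: ln_div ln_mult)
    then show ?thesis
      using diff_le_mult_ln_divide[of "a t" "real (N + 1) * m"] \<open>0 < a t\<close> m
      by (simp add: right_diff_distrib)
  qed
  have others: "(\<Sum>j \<in> {0..N} - {t}. a j - m) \<le> (\<Sum>j \<in> {0..N} - {t}. a j * ln (a j / m))"
    using nonneg m by (intro sum_mono diff_le_mult_ln_divide) auto
  have "(\<Sum>j \<in> {0..N} - {t}. a j - m) = (\<Sum>j \<in> {0..N} - {t}. a j) - real N * m"
    using t by (simp add: sum_subtractf)
  moreover have "(\<Sum>j = 0..N. a j) = a t + (\<Sum>j \<in> {0..N} - {t}. a j)"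
    using t by (intro sum.remove) auto
  moreover have "(\<Sum>j = 0..N. a j * ln (a j / m)) =
      a t * ln (a t / m) + (\<Sum>j \<in> {0..N} - {t}. a j * ln (a j / m))"
    using t by (intro sum.remove) auto
  ultimately show ?thesis using at others total by linarith
qed

section \<open>Divergence from a dominating density\<close>

text \<open>The integrand lies between \<open>p - q\<close> and \<open>p ln c\<close>, and both are integrable.\<close>
lemma integrable_mult_ln_divide:
  fixes p q :: "'a \<Rightarrow> real"
  assumes p: "integrable \<mu> p" and q: "integrable \<mu> q" and c: "0 < c"
    and nonneg: "\<And>x. x \<in> space \<mu> \<Longrightarrow> 0 \<le> p x"
    and le: "\<And>x. x \<in> space \<mu> \<Longrightarrow> p x \<le> c * q x"
  shows "integrable \<mu> (\<lambda>x. p x * ln (p x / q x))"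
proof (rule Bochner_Integration.integrable_bound)
  show "integrable \<mu> (\<lambda>x. \<bar>p x - q x\<bar> + \<bar>p x * ln c\<bar>)"
    using p q by simp
  show "(\<lambda>x. p x * ln (p x / q x)) \<in> borel_measurable \<mu>"
    using p q by (auto dest!: borel_measurable_integrable)
  show "AE x in \<mu>. norm (p x * ln (p x / q x)) \<le> norm (\<bar>p x - q x\<bar> + \<bar>p x * ln c\<bar>)"
  proof (rule AE_I2)
    fix x assume x: "x \<in> space \<mu>"
    show "norm (p x * ln (p x / q x)) \<le> norm (\<bar>p x - q x\<bar> + \<bar>p x * ln c\<bar>)"
    proof (cases "p x = 0")
      case False
      then have "0 < c * q x" using nonneg[OF x] le[OF x] by simp
      then have "0 < q x" using c by (simp add: zero_less_mult_iff)
      then show ?thesis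
        using diff_le_mult_ln_divide[of "p x" "q x"] mult_ln_divide_le[of "p x" c "q x"]
          nonneg[OF x] le[OF x] c by simp
    qed simp
  qed
qed

lemma KL_density_eq_integral:
  fixes p q :: "'a \<Rightarrow> real"
  assumes p: "integrable \<mu> p" and q: "integrable \<mu> q" and c: "0 < c"
    and nonneg: "\<And>x. x \<in> space \<mu> \<Longrightarrow> 0 \<le> p x"
    and le: "\<And>x. x \<in> space \<mu> \<Longrightarrow> p x \<le> c * q x"
  shows "KL_density \<mu> p q = ereal (\<integral>x. p x * ln (p x / q x) \<partial>\<mu>)"
proof -
  let ?f = "\<lambda>x. p x * ln (p x / q x)"
  have [measurable]: "p \<in> borel_measurable \<mu>" "q \<in> borel_measurable \<mu>"
    using p q by auto
  have ac: "absolutely_continuous (density \<mu> (\<lambda>x. ennreal (q x))) (density \<mu> (\<lambda>x. ennreal (p x)))"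
    unfolding absolutely_continuous_def
  proof
    fix A assume "A \<in> null_sets (density \<mu> (\<lambda>x. ennreal (q x)))"
    then have A: "A \<in> sets \<mu>" "AE x in \<mu>. x \<in> A \<longrightarrow> ennreal (q x) = 0"
      by (auto simp: null_sets_density_iff)
    have "AE x in \<mu>. x \<in> A \<longrightarrow> ennreal (p x) = 0"
      using A(2)
    proof (rule AE_mp, intro AE_I2 impI)
      fix x assume x: "x \<in> space \<mu>" "x \<in> A \<longrightarrow> ennreal (q x) = 0" "x \<in> A"
      then have "c * q x \<le> 0" using c by (simp add: ennreal_eq_0_iff mult_le_0_iff)
      then show "ennreal (p x) = 0" using le[OF x(1)] by (simp add: ennreal_eq_0_iff)
    qed
    then show "A \<in> null_sets (density \<mu> (\<lambda>x. ennreal (p x)))"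
      using A(1) by (auto simp: null_sets_density_iff)
  qed
  have f: "integrable \<mu> ?f"
    using assms by (rule integrable_mult_ln_divide)
  obtain r s where "0 \<le> r" "0 \<le> s" "(\<integral>\<^sup>+ x. ennreal (?f x) \<partial>\<mu>) = ennreal r"
    "(\<integral>\<^sup>+ x. ennreal (- ?f x) \<partial>\<mu>) = ennreal s" "(\<integral>x. ?f x \<partial>\<mu>) = r - s"
    using f by (rule integrableE)
  then show ?thesis
    unfolding KL_density_def using ac by (simp only: if_True enn2ereal_ennreal ereal_minus)
qed

section \<open>The bound on the mean success probability\<close>

theorem mainTheorem3:
  fixes \<mu> :: "'a measure"
    and N :: nat
    and p :: "nat \<Rightarrow> 'a \<Rightarrow> real"
    and P :: "nat \<Rightarrow> 'a measure"
  assumes "N \<ge> 2"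
    and "\<And>j. j \<in> {0..N} \<Longrightarrow> p j \<in> borel_measurable \<mu>"
    and "\<And>j x. j \<in> {0..N} \<Longrightarrow> x \<in> space \<mu> \<Longrightarrow> 0 \<le> p j x"
    and "\<And>j. j \<in> {0..N} \<Longrightarrow> P j = density \<mu> (\<lambda>x. ennreal (p j x))"
    and "\<And>j. j \<in> {0..N} \<Longrightarrow> prob_space (P j)"
    and "inj_on P {0..N}"
  shows "ereal (max_mean_success \<mu> N P)
           \<le> (mean_KL \<mu> N p + ereal (real N / real (N + 1))) / ereal (ln (real (N + 1)))
       \<and> (mean_KL \<mu> N p + ereal (real N / real (N + 1))) / ereal (ln (real (N + 1)))
           \<le> (mean_KL \<mu> N p + 1) / ereal (ln (real (N + 1)))"
proof -
  let ?n = "real (N + 1)"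
  let ?L = "ln ?n"
  let ?m = "mean_density N p"
  have L: "0 < ?L" using \<open>N \<ge> 2\<close> by simp
  have mass: "(\<integral>\<^sup>+ x. ennreal (p j x) \<partial>\<mu>) = 1" if "j \<le> N" for j
  proof -
    interpret prob_space "P j" using assms(5) that by simp
    have "emeasure (P j) (space \<mu>) = 1"
      using emeasure_space_1 assms(4)[of j] that by simp
    moreover have "emeasure (P j) (space \<mu>) = (\<integral>\<^sup>+ x. ennreal (p j x) \<partial>\<mu>)"
      using assms(2,4)[of j] that
      by (simp add: emeasure_density cong: nn_integral_cong)
    ultimately show ?thesis by simp
  qed
  have p: "integrable \<mu> (p j)" if "j \<le> N" for j
    using assms(2,3)[of j] mass[OF that] that
    by (intro integrableI_nonneg) auto
  have p1: "(\<integral>x. p j x \<partial>\<mu>) = 1" if "j \<le> N" for j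
    using assms(2,3)[of j] mass[OF that] that
    by (subst integral_eq_nn_integral) auto
  have m: "integrable \<mu> ?m"
    unfolding mean_density_def[abs_def] using p
    by (intro integrable_mult_right Bochner_Integration.integrable_sum) auto
  have m1: "(\<integral>x. ?m x \<partial>\<mu>) = 1"
    unfolding mean_density_def using p p1 by simp
  have le: "p j x \<le> ?n * ?m x" if "j \<le> N" "x \<in> space \<mu>" for j x
    using assms(3) that by (intro le_mult_mean_density) auto
  have nonneg: "0 \<le> p j x" if "j \<le> N" "x \<in> space \<mu>" for j x
    using assms(3) that by simp
  let ?f = "\<lambda>j x. p j x * ln (p j x / ?m x)"
  have f: "integrable \<mu> (?f j)" if "j \<le> N" for j
    using p[OF that] m _ nonneg[OF that] le[OF that] by (rule integrable_mult_ln_divide) simp_all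
  define K where "K = (\<Sum>j = 0..N. \<integral>x. ?f j x \<partial>\<mu>) / ?n"
  have "KL_density \<mu> (p j) ?m = ereal (\<integral>x. ?f j x \<partial>\<mu>)" if "j \<le> N" for j
    using p[OF that] m _ nonneg[OF that] le[OF that] by (rule KL_density_eq_integral) simp_all
  then have K: "mean_KL \<mu> N p = ereal K"
    by (simp add: mean_KL_def K_def)
  have success: "1 / ?n * (\<Sum>j = 0..N. measure (P j) {x \<in> space \<mu>. T x = j})
      \<le> (K + real N / ?n) / ?L" (is "?S \<le> _")
    if T[measurable]: "T \<in> measurable \<mu> (count_space {0..N})" for T
  proof -
    let ?A = "\<lambda>j. {x \<in> space \<mu>. T x = j}"
    have A: "?A j \<in> sets \<mu>" if "j \<le> N" for j
      using measurable_sets[OF T, of "{j}"] that by (simp add: vimage_def Int_def conj_commute)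
    have pA: "integrable \<mu> (\<lambda>x. p j x * indicator (?A j) x)" if "j \<le> N" for j
      using A[OF that] p[OF that] by (rule integrable_real_mult_indicator)
    have meas: "measure (P j) (?A j) = (\<integral>x. p j x * indicator (?A j) x \<partial>\<mu>)" if "j \<le> N" for j
    proof -
      have nn: "AE x in \<mu>. 0 \<le> p j x * indicator (?A j) x"
        using nonneg[OF that] by (intro AE_I2) simp
      have "emeasure (P j) (?A j) = (\<integral>\<^sup>+ x. ennreal (p j x) * indicator (?A j) x \<partial>\<mu>)"
        using assms(2,4)[of j] A[OF that] that by (simp add: emeasure_density)
      also have "\<dots> = (\<integral>\<^sup>+ x. ennreal (p j x * indicator (?A j) x) \<partial>\<mu>)"
        by (intro nn_integral_cong) (simp add: indicator_def)
      also have "\<dots> = ennreal (\<integral>x. p j x * indicator (?A j) x \<partial>\<mu>)"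
        using pA[OF that] nn by (rule nn_integral_eq_integral)
      finally show ?thesis
        using integral_nonneg_AE[OF nn] by (simp add: measure_def)
    qed
    define g where "g x = (\<Sum>j = 0..N. p j x * indicator (?A j) x)" for x
    have g: "integrable \<mu> g"
      unfolding g_def[abs_def] using pA by (intro Bochner_Integration.integrable_sum) auto
    have g_int: "(\<integral>x. g x \<partial>\<mu>) = (\<Sum>j = 0..N. measure (P j) (?A j))"
      unfolding g_def using pA meas by (subst Bochner_Integration.integral_sum) auto
    have "(\<Sum>j = 0..N. measure (P j) (?A j)) * ?L - real N
        = (\<integral>x. g x * ?L - real N * ?m x \<partial>\<mu>)"
      using g m m1 g_int by simp
    also have "\<dots> \<le> (\<integral>x. (\<Sum>j = 0..N. ?f j x) \<partial>\<mu>)"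
    proof (rule integral_mono)
      fix x assume x: "x \<in> space \<mu>"
      have Tx: "T x \<le> N" using measurable_space[OF T x] by simp
      have "g x = (\<Sum>j = 0..N. if j = T x then p j x else 0)"
        unfolding g_def using x by (intro sum.cong) (auto simp: indicator_def)
      also have "\<dots> = p (T x) x" using Tx by simp
      finally show "g x * ?L - real N * ?m x
          \<le> (\<Sum>j = 0..N. ?f j x)"
        using sum_mult_ln_ge[of N "\<lambda>j. p j x" "?m x" "T x"] nonneg[OF _ x] Tx
        by (simp add: mean_density_def)
    qed (use g m f in \<open>auto intro!: Bochner_Integration.integrable_diff\<close>)
    also have "\<dots> = ?n * K"
      using f by (simp add: K_def)
    finally have "((\<Sum>j = 0..N. measure (P j) (?A j)) * ?L) / ?n \<le> (?n * K + real N) / ?n"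
      by (intro divide_right_mono) auto
    then have "?S * ?L \<le> K + real N / ?n"
      by (simp add: add_divide_distrib)
    then show ?thesis using L by (simp add: pos_le_divide_eq)
  qed
  have "max_mean_success \<mu> N P \<le> (K + real N / ?n) / ?L"
    unfolding max_mean_success_def
  proof (rule cSUP_least)
    have "(\<lambda>_. 0) \<in> measurable \<mu> (count_space {0..N})" by simp
    then show "measurable \<mu> (count_space {0..N}) \<noteq> {}" by blast
  qed (rule success)
  moreover have "(K + real N / ?n) / ?L \<le> (K + 1) / ?L"
    using L by (intro divide_right_mono) auto
  moreover have "mean_KL \<mu> N p + 1 = ereal (K + 1)"
    by (simp add: K one_ereal_def)
  ultimately show ?thesis
    using L by (simp only: K plus_ereal.simps ereal_divide) simp
qed

end
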